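(* Let $\eta_s\in(0,1]$ be given. When a short-selling ban is in place, the bid-ask spread increases relative to the unconstrained case, i.e. $\widetilde{Ask}-\widetilde{Bid}>Ask-Bid$, if and only if $\frac{h_I}{h_N}>1$.
   Context: Parameters: $p,\alpha\in(0,1)$, $g\in(0,1]$, $h_I,h_N\in(0,1]$. The asset value $V$ is Bernoulli with $P(V=1)=p$, $P(V=0)=1-p$. One trader arrives. With probability $1-g$ he is inactive (no trade). With probability $g$ he is active; an active trader is informed with probability $\alpha$ and noise with probability $1-\alpha$. An active informed trader buys if $V=1$ and wants to sell if $V=0$. An active noise trader wants to sell with probability $\eta_s$ and buys with probability $1-\eta_s$, independently of $V$. An informed (resp. noise) trader owns the stock with probability $h_I$ (resp. $h_N$), independently of everything else. Without a ban, every trader who wants to sell does so (shorting if he does not own the stock). With a ban, a trader who wants to sell but does not own the stock does not trade (no trade is observed); buying is unaffected. Market makers know $\eta_s$ and quote the conditional expectations of $V$ given the observed order. Without a ban: $Bid=\mathbb{E}[V\mid Sell]=\frac{(1-\alpha)\eta_s p}{(1-\alpha)\eta_s+\alpha(1-p)}$ and $Ask=\mathbb{E}[V\mid Buy]=\frac{(1-\alpha)(1-\eta_s)p+\alpha p}{(1-\alpha)(1-\eta_s)+\alpha p}$. With a ban, the corresponding conditional expectations are $\widetilde{Bid}=\frac{(1-\alpha)h_N\eta_s p}{\alpha h_I(1-p)+(1-\alpha)h_N\eta_s}$ and $\widetilde{Ask}=\frac{(1-\alpha)(1-\eta_s)p+\alpha p}{(1-\alpha)(1-\eta_s)+\alpha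 p}$. The bid-ask spread is ask minus bid. *)

theory Defs
  imports "HOL-Probability.Probability"
begin

(* An outcome records every random attribute, including those that turn out irrelevant
   (e.g. the noise trader's wish when the trader is informed). *)
datatype outcome = Outcome
  (high_value: bool)
  (active: bool)
  (informed: bool)
  (noise_wants_sell: bool)
  (owns_stock: bool)

definition market :: "real \<Rightarrow> real \<Rightarrow> real \<Rightarrow> real \<Rightarrow> real \<Rightarrow> real \<Rightarrow> outcome pmf" where
  "market p \<alpha> g h\<^sub>I h\<^sub>N \<eta>\<^sub>s = do {
     v \<leftarrow> bernoulli_pmf p;
     act \<leftarrow> bernoulli_pmf g;
     inf \<leftarrow> bernoulli_pmf \<alpha>;
     sell \<leftarrow> bernoulli_pmf \<eta>\<^sub>s;
     own \<leftarrow> bernoulli_pmf (if inf then h\<^sub>I else h\<^sub>N);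
     return_pmf (Outcome v act inf sell own)
   }"

definition asset_value :: "outcome \<Rightarrow> real" where
  "asset_value \<omega> = of_bool (high_value \<omega>)"

definition wants_sell :: "outcome \<Rightarrow> bool" where
  "wants_sell \<omega> \<longleftrightarrow> (if informed \<omega> then \<not> high_value \<omega> else noise_wants_sell \<omega>)"

datatype trade = Buy | Sell | No_Trade

datatype regime = Unconstrained | Short_Ban

definition observed_trade :: "regime \<Rightarrow> outcome \<Rightarrow> trade" where
  "observed_trade r \<omega> =
     (if \<not> active \<omega> then No_Trade
      else if \<not> wants_sell \<omega> then Buy
      else if r = Short_Ban \<and> \<not> owns_stock \<omega> then No_Trade
      else Sell)"

(* cond_pmf is meaningful only if the trade has positive probability; for buys and sells this
   holds for all parameters under consideration. *)
definition quote_price :: "outcome pmf \<Rightarrow> regime \<Rightarrow> trade \<Rightarrow> real" where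
  "quote_price M r t =
     measure_pmf.expectation (cond_pmf M {\<omega>. observed_trade r \<omega> = t}) asset_value"

definition ask :: "outcome pmf \<Rightarrow> regime \<Rightarrow> real" where
  "ask M r = quote_price M r Buy"

definition bid :: "outcome pmf \<Rightarrow> regime \<Rightarrow> real" where
  "bid M r = quote_price M r Sell"

definition bid_ask_spread :: "outcome pmf \<Rightarrow> regime \<Rightarrow> real" where
  "bid_ask_spread M r = ask M r - bid M r"

end

theory Submission
  imports Defs
begin

text \<open>A ban turns some sells into no trade but leaves every buy intact, so the ask does not
  move (\<open>ask_Short_Ban\<close>) and the spread widens exactly when the bid falls. Given
  activity, sells come from noise traders with mass
  \<open>a = (1 - \<alpha>) * \<eta>\<^sub>s\<close> and from informed traders with mass
  \<open>b = \<alpha> * (1 - p)\<close>. Only the noise sells are compatible with a high value, so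
  by Bayes the bid is \<open>p\<close> times the noise share of sells
  (\<open>bid_Unconstrained\<close>). The ban reweights the masses to \<open>h\<^sub>N * a\<close>
  and \<open>h\<^sub>I * b\<close> (\<open>bid_Short_Ban\<close>), and the noise share drops iff
  \<open>h\<^sub>N < h\<^sub>I\<close>. The event probabilities come from splitting the model one
  coin at a time.\<close>

lemma measure_bind_bernoulli_pmf:
  assumes "0 \<le> q" and "q \<le> 1"
  shows "measure_pmf.prob (bind_pmf (bernoulli_pmf q) f) A =
           q * measure_pmf.prob (f True) A + (1 - q) * measure_pmf.prob (f False) A"
proof -
  \<comment> \<open>In \<open>ennreal\<close> the bind is a nonnegative integral over a two-point
    distribution; injectivity of \<open>ennreal\<close> on nonnegative reals brings the identity
    back.\<close>
  have "ennreal (measure_pmf.prob (bind_pmf (bernoulli_pmf q) f) A) =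
          ennreal (q * measure_pmf.prob (f True) A + (1 - q) * measure_pmf.prob (f False) A)"
    using assms
    by (simp add: measure_pmf.emeasure_eq_measure [symmetric] ennreal_plus ennreal_mult)
       (simp add: measure_pmf.emeasure_eq_measure ennreal_mult mult.commute)
  then show ?thesis
    using assms by (subst (asm) ennreal_inj) auto
qed

lemma measure_cond_pmf:
  assumes "measure_pmf.prob M S > 0"
  shows "measure_pmf.prob (cond_pmf M S) A = measure_pmf.prob M (S \<inter> A) / measure_pmf.prob M S"
proof -
  \<comment> \<open>The defining equation of \<open>cond_pmf\<close> is available only when the
    support meets the event.\<close>
  have ne: "set_pmf M \<inter> S \<noteq> {}"
    using assms by (metis less_irrefl measure_Int_set_pmf inf_commute measure_empty)
  have "emeasure (measure_pmf M) S \<noteq> 0"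
    using assms by (simp add: measure_pmf.emeasure_eq_measure)
  then show ?thesis
    by (simp add: cond_pmf.rep_eq[OF ne] measure_uniform_measure)
qed

text \<open>The asset value is an indicator, so its conditional expectation is a conditional
  probability.\<close>

lemma quote_price_eq:
  assumes "measure_pmf.prob M {\<omega>. observed_trade r \<omega> = t} > 0"
  shows "quote_price M r t =
           measure_pmf.prob M {\<omega>. observed_trade r \<omega> = t \<and> high_value \<omega>} /
           measure_pmf.prob M {\<omega>. observed_trade r \<omega> = t}"
proof -
  have av: "asset_value = indicator {\<omega>. high_value \<omega>}"
    by (auto simp: asset_value_def fun_eq_iff)
  show ?thesis
    unfolding quote_price_def av
    by (simp add: measure_cond_pmf[OF assms] Collect_conj_eq)
qed

lemma ask_Short_Ban: "ask M Short_Ban = ask M Unconstrained"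
proof -
  have "observed_trade Short_Ban \<omega> = Buy \<longleftrightarrow> observed_trade Unconstrained \<omega> = Buy" for \<omega>
    by (simp add: observed_trade_def)
  then show ?thesis
    by (simp add: ask_def quote_price_def)
qed

context
  fixes p \<alpha> g h\<^sub>I h\<^sub>N \<eta>\<^sub>s :: real
  assumes p: "0 < p" "p < 1" and \<alpha>: "0 < \<alpha>" "\<alpha> < 1" and g: "0 < g" "g \<le> 1"
    and hI: "0 < h\<^sub>I" "h\<^sub>I \<le> 1" and hN: "0 < h\<^sub>N" "h\<^sub>N \<le> 1" and \<eta>: "0 < \<eta>\<^sub>s" "\<eta>\<^sub>s \<le> 1"
begin

lemma bid_Unconstrained:
  "bid (market p \<alpha> g h\<^sub>I h\<^sub>N \<eta>\<^sub>s) Unconstrained =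
     (1 - \<alpha>) * \<eta>\<^sub>s * p / ((1 - \<alpha>) * \<eta>\<^sub>s + \<alpha> * (1 - p))"
proof -
  let ?M = "market p \<alpha> g h\<^sub>I h\<^sub>N \<eta>\<^sub>s"
  \<comment> \<open>Each bind splits on one coin; at the leaves only an indicator of the event
    remains.\<close>
  have s: "measure_pmf.prob ?M {\<omega>. observed_trade Unconstrained \<omega> = Sell} =
      g * ((1 - \<alpha>) * \<eta>\<^sub>s + \<alpha> * (1 - p))"
    using p \<alpha> g hI hN \<eta>
    by (simp add: market_def measure_bind_bernoulli_pmf observed_trade_def wants_sell_def
        indicator_def algebra_simps)
  have hs: "measure_pmf.prob ?M {\<omega>. observed_trade Unconstrained \<omega> = Sell \<and> high_value \<omega>} =
      g * ((1 - \<alpha>) * \<eta>\<^sub>s * p)"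
    using p \<alpha> g hI hN \<eta>
    by (simp add: market_def measure_bind_bernoulli_pmf observed_trade_def wants_sell_def
        indicator_def algebra_simps)
  \<comment> \<open>Sells have positive probability, so conditioning is meaningful; the common
    factor \<open>g\<close> then cancels.\<close>
  have "0 < g * ((1 - \<alpha>) * \<eta>\<^sub>s + \<alpha> * (1 - p))"
    using p \<alpha> g \<eta> by (simp add: add_pos_pos)
  then show ?thesis
    using g by (simp add: bid_def quote_price_eq s hs)
qed

text \<open>Ownership is drawn after the trader's type, so each type's selling mass is scaled by its
  own ownership probability.\<close>

lemma bid_Short_Ban:
  "bid (market p \<alpha> g h\<^sub>I h\<^sub>N \<eta>\<^sub>s) Short_Ban =
     (1 - \<alpha>) * h\<^sub>N * \<eta>\<^sub>s * p / (\<alpha> * h\<^sub>I * (1 - p) + (1 - \<alpha>) * h\<^sub>N * \<eta>\<^sub>s)"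
proof -
  let ?M = "market p \<alpha> g h\<^sub>I h\<^sub>N \<eta>\<^sub>s"
  have s: "measure_pmf.prob ?M {\<omega>. observed_trade Short_Ban \<omega> = Sell} =
      g * (\<alpha> * h\<^sub>I * (1 - p) + (1 - \<alpha>) * h\<^sub>N * \<eta>\<^sub>s)"
    using p \<alpha> g hI hN \<eta>
    by (simp add: market_def measure_bind_bernoulli_pmf observed_trade_def wants_sell_def
        indicator_def algebra_simps)
  have hs: "measure_pmf.prob ?M {\<omega>. observed_trade Short_Ban \<omega> = Sell \<and> high_value \<omega>} =
      g * ((1 - \<alpha>) * h\<^sub>N * \<eta>\<^sub>s * p)"
    using p \<alpha> g hI hN \<eta>
    by (simp add: market_def measure_bind_bernoulli_pmf observed_trade_def wants_sell_def
        indicator_def algebra_simps)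
  have "0 < g * (\<alpha> * h\<^sub>I * (1 - p) + (1 - \<alpha>) * h\<^sub>N * \<eta>\<^sub>s)"
    using p \<alpha> g hI hN \<eta> by (simp add: add_pos_pos)
  then show ?thesis
    using g by (simp add: bid_def quote_price_eq s hs)
qed

end

theorem lemma2:
  fixes p \<alpha> g h\<^sub>I h\<^sub>N \<eta>\<^sub>s :: real
  assumes "p \<in> {0<..<1}" and "\<alpha> \<in> {0<..<1}"
    and "g \<in> {0<..1}" and "h\<^sub>I \<in> {0<..1}" and "h\<^sub>N \<in> {0<..1}"
    and "\<eta>\<^sub>s \<in> {0<..1}"
  shows "bid_ask_spread (market p \<alpha> g h\<^sub>I h\<^sub>N \<eta>\<^sub>s) Short_Ban
           > bid_ask_spread (market p \<alpha> g h\<^sub>I h\<^sub>N \<eta>\<^sub>s) Unconstrained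
         \<longleftrightarrow> h\<^sub>I / h\<^sub>N > 1"
proof -
  define a where "a = (1 - \<alpha>) * \<eta>\<^sub>s"
  define b where "b = \<alpha> * (1 - p)"
  have pos: "0 < a" "0 < b" "0 < p" "0 < h\<^sub>I" "0 < h\<^sub>N"
    using assms by (auto simp: a_def b_def)
  let ?M = "market p \<alpha> g h\<^sub>I h\<^sub>N \<eta>\<^sub>s"
  have U: "bid ?M Unconstrained = a * p / (a + b)"
    using assms by (simp add: bid_Unconstrained a_def b_def)
  have B: "bid ?M Short_Ban = h\<^sub>N * a * p / (h\<^sub>I * b + h\<^sub>N * a)"
    using assms by (simp add: bid_Short_Ban a_def b_def mult_ac)
  have "bid_ask_spread ?M Short_Ban > bid_ask_spread ?M Unconstrained
          \<longleftrightarrow> h\<^sub>N * a * p / (h\<^sub>I * b + h\<^sub>N * a) < a * p / (a + b)"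
    by (simp add: bid_ask_spread_def ask_Short_Ban U B)
  also have "\<dots> \<longleftrightarrow> h\<^sub>N * a * p * (a + b) < a * p * (h\<^sub>I * b + h\<^sub>N * a)"
    using pos by (simp add: add_pos_pos frac_less_eq pos_divide_less_eq pos_less_divide_eq)
  \<comment> \<open>The term \<open>h\<^sub>N * a * a * p\<close> occurs on both sides and cancels,
    leaving a common positive factor.\<close>
  also have "\<dots> \<longleftrightarrow> (a * b * p) * h\<^sub>N < (a * b * p) * h\<^sub>I"
    by (simp add: algebra_simps)
  also have "\<dots> \<longleftrightarrow> h\<^sub>I / h\<^sub>N > 1"
    using pos by simp
  finally show ?thesis .
qed

end
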